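(* Let $C/\mathbb F_q$ be a smooth, projective, geometrically connected curve of genus $g\ge1$, and $N_n=\#C(\mathbb F_{q^n})$. Let $\alpha_1,\dots,\alpha_{2g}$ be its reciprocal Frobenius roots, and group the equal normalized roots $\alpha_j/q^{1/2}$ into distinct phases $e^{i\theta_1},\dots,e^{i\theta_r}$ with multiplicities $m_1,\dots,m_r$. With $\Theta=(\theta_1,\dots,\theta_r)$ and $m=(m_1,\dots,m_r)$, $$\limsup_{n\to\infty}\frac{|N_n-q^n-1|}{q^{n/2}}\ge q_\Theta(-m),$$ and in fact $$\limsup_{n\to\infty}\frac{|N_n-q^n-1|}{q^{n/2}}=\max_{z\in G_\Theta}\left|\sum_{\nu=1}^rm_\nu z_\nu\right|.$$
   Context: The reciprocal Frobenius roots satisfy (Weil, Deligne) $N_n=q^n+1-\sum_{j=1}^{2g}\alpha_j^n$ for $n\ge1$ and $|\alpha_j|=q^{1/2}$; these facts are taken as known. With $\Psi_\Theta(n)=(e^{in\theta_1},\dots,e^{in\theta_r})$, let $G_\Theta=\overline{\Psi_\Theta(\mathbb Z)}\subseteq\mathbb T^r$, $\mathbb T=\{|z|=1\}$ (a compact group) with Haar probability measure $m_\Theta$ and restricted coordinate characters $\chi_\nu(z)=z_\nu$. For $a\in\mathbb C^r$, $$q_\Theta(a)=\inf\Bigl\{\|f\|_{L^\infty(G_\Theta)}:\ f\in L^\infty(G_\Theta),\ \int_{G_\Theta}f\overline{\chi_\nu}\,dm_\Theta=a_\nu\ (1\le\nu\le r)\Bigr\}.$$ *)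

theory Defs
  imports
    "HOL-Analysis.Analysis"
    "HOL-Probability.Essential_Supremum"
    "HOL-Probability.Probability_Measure"
    "HOL-Library.Poly_Mapping"
    "HOL-Computational_Algebra.Formal_Power_Series"
    "HOL-Algebra.Algebraic_Closure_Type"
begin

section \<open>Polynomials in the variables indexed by a finite type\<close>

type_synonym ('i, 'a) mpoly = "('i \<Rightarrow>\<^sub>0 nat) \<Rightarrow>\<^sub>0 'a"

definition mono_degree :: "('i::finite \<Rightarrow>\<^sub>0 nat) \<Rightarrow> nat" where
  "mono_degree \<mu> = (\<Sum>i\<in>UNIV. Poly_Mapping.lookup \<mu> i)"

definition homogeneous :: "nat \<Rightarrow> ('i::finite, 'a::zero) mpoly \<Rightarrow> bool" where
  "homogeneous d f \<longleftrightarrow> (\<forall>\<mu>\<in>Poly_Mapping.keys f. mono_degree \<mu> = d)"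

definition eval_mpoly :: "('i::finite, 'a::comm_ring_1) mpoly \<Rightarrow> 'a ^ 'i \<Rightarrow> 'a" where
  "eval_mpoly f x = (\<Sum>\<mu>\<in>Poly_Mapping.keys f. Poly_Mapping.lookup f \<mu> * (\<Prod>i\<in>UNIV. (x $ i) ^ Poly_Mapping.lookup \<mu> i))"

definition partial_mpoly :: "'i::finite \<Rightarrow> ('i, 'a::comm_ring_1) mpoly \<Rightarrow> ('i, 'a) mpoly" where
  "partial_mpoly i f =
     (\<Sum>\<mu>\<in>Poly_Mapping.keys f. Poly_Mapping.single (\<mu> - Poly_Mapping.single i 1)
                                     (of_nat (Poly_Mapping.lookup \<mu> i) * Poly_Mapping.lookup f \<mu>))"

abbreviation base_change :: "('i, 'k::field) mpoly \<Rightarrow> ('i, 'k alg_closure) mpoly" where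
  "base_change \<equiv> Poly_Mapping.map to_ac"

section \<open>Projective space over an algebraic closure, with its Zariski topology\<close>

text \<open>A point of the projective space with homogeneous coordinates indexed by \<open>'i\<close> (so of
  dimension \<open>CARD('i) - 1\<close>) is the set of all its coordinate vectors.\<close>

definition proj_point :: "'a::field ^ 'i::finite \<Rightarrow> ('a ^ 'i) set" where
  "proj_point x = {c *s x | c. c \<noteq> 0}"

definition proj_space :: "('a::field ^ 'i::finite) set set" where
  "proj_space = {proj_point x | x. x \<noteq> 0}"

definition proj_zeros :: "('i::finite, 'a::field) mpoly set \<Rightarrow> ('a ^ 'i) set set" where
  "proj_zeros S = {P \<in> proj_space. \<forall>f\<in>S. \<forall>x\<in>P. eval_mpoly f x = 0}"

definition zariski_topology :: "('a::field ^ 'i::finite) set topology" where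
  "zariski_topology =
     topology_generated_by {proj_space - proj_zeros {f} | f d. homogeneous d f}"

section \<open>Irreducibility and Krull dimension of topological spaces\<close>

definition irreducible_closed :: "'a topology \<Rightarrow> 'a set \<Rightarrow> bool" where
  "irreducible_closed T S \<longleftrightarrow> closedin T S \<and> S \<noteq> {} \<and>
     (\<forall>A B. closedin T A \<and> closedin T B \<and> S \<subseteq> A \<union> B \<longrightarrow> S \<subseteq> A \<or> S \<subseteq> B)"

definition irreducible_component :: "'a topology \<Rightarrow> 'a set \<Rightarrow> bool" where
  "irreducible_component T S \<longleftrightarrow> irreducible_closed T S \<and>
     (\<forall>S'. irreducible_closed T S' \<and> S \<subseteq> S' \<longrightarrow> S' = S)"

definition krull_dim :: "'a topology \<Rightarrow> enat" where
  "krull_dim T = Sup {enat n | n. \<exists>Z :: nat \<Rightarrow> 'a set.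
     (\<forall>i\<le>n. irreducible_closed T (Z i)) \<and> (\<forall>i<n. Z i \<subset> Z (Suc i))}"

section \<open>Smooth projective geometrically connected curves over a finite field\<close>

text \<open>A projective scheme over \<open>'k\<close> is presented by a set \<open>F\<close> of homogeneous polynomials
  over \<open>'k\<close>, as \<open>Proj ('k[x]/(F))\<close>. Its geometric points are the common zeros of \<open>F\<close> over the
  algebraic closure; they carry the same connectedness and dimension theory as the scheme
  base-changed to the algebraic closure, whose closed points they are.\<close>

definition geom_points :: "('i::finite, 'k::field) mpoly set \<Rightarrow> ('k alg_closure ^ 'i) set set" where
  "geom_points F = proj_zeros (base_change ` F)"

definition geom_space :: "('i::finite, 'k::field) mpoly set \<Rightarrow> ('k alg_closure ^ 'i) set topology" where
  "geom_space F = subtopology zariski_topology (geom_points F)"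

definition gradient ::
  "('i::finite, 'k::field) mpoly \<Rightarrow> 'k alg_closure ^ 'i \<Rightarrow> 'k alg_closure ^ 'i" where
  "gradient f x = (\<chi> i. eval_mpoly (partial_mpoly i (base_change f)) x)"

text \<open>Smoothness is the Jacobian criterion for the given equations, at every geometric point: in
  projective space of dimension \<open>CARD('i) - 1\<close>, the Jacobian matrix of a curve has rank
  \<open>CARD('i) - 2\<close>. As \<open>F\<close> is not required to generate a radical ideal, this also forces the scheme
  to be reduced.\<close>

definition smooth_proj_geom_conn_curve :: "('i::finite, 'k::field) mpoly set \<Rightarrow> bool" where
  "smooth_proj_geom_conn_curve F \<longleftrightarrow>
     (\<forall>f\<in>F. \<exists>d. homogeneous d f) \<and>
     geom_points F \<noteq> {} \<and>
     connected_space (geom_space F) \<and>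
     (\<forall>S. irreducible_component (geom_space F) S \<longrightarrow> krull_dim (subtopology (geom_space F) S) = 1) \<and>
     (\<forall>P\<in>geom_points F. \<forall>x\<in>P. vec.dim ((\<lambda>f. gradient f x) ` F) + 2 = CARD('i))"

subsection \<open>Genus\<close>

definition ideal_of :: "('i::finite, 'k::field) mpoly set \<Rightarrow> ('i, 'k) mpoly set" where
  "ideal_of F = module.span (*) F"

definition mpoly_dim :: "('i::finite, 'k::field) mpoly set \<Rightarrow> nat" where
  "mpoly_dim V = vector_space.dim (\<lambda>c f. Poly_Mapping.single 0 c * f) V"

text \<open>The dimension over \<open>'k\<close> of the degree \<open>d\<close> part of \<open>'k[x]/(F)\<close>.\<close>

definition hilbert_function :: "('i::finite, 'k::field) mpoly set \<Rightarrow> nat \<Rightarrow> nat" where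
  "hilbert_function F d =
     mpoly_dim {f :: ('i, 'k) mpoly. homogeneous d f} - mpoly_dim {f \<in> ideal_of F. homogeneous d f}"

definition hilbert_polynomial :: "('i::finite, 'k::field) mpoly set \<Rightarrow> rat poly" where
  "hilbert_polynomial F =
     (THE p. \<forall>\<^sub>F d in sequentially. poly p (of_nat d) = of_nat (hilbert_function F d))"

text \<open>The Hilbert polynomial takes at 0 the value \<open>\<chi>(O)\<close>, with \<open>O\<close> the structure sheaf. For a
  smooth projective geometrically connected curve \<open>dim H\<^sup>0(O) = 1\<close>, so \<open>1 - \<chi>(O)\<close> is
  \<open>dim H\<^sup>1(O)\<close>, the genus.\<close>

definition genus :: "('i::finite, 'k::field) mpoly set \<Rightarrow> rat" where
  "genus F = 1 - poly (hilbert_polynomial F) 0"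

subsection \<open>Point counts, zeta function and Frobenius roots\<close>

text \<open>The subfield with \<open>q ^ n\<close> elements of the algebraic closure of \<open>'k\<close>, where \<open>q = CARD('k)\<close>
  and \<open>n \<ge> 1\<close>.\<close>

definition finite_subfield :: "nat \<Rightarrow> ('k::{field,finite}) alg_closure set" where
  "finite_subfield n = {a. a ^ (CARD('k) ^ n) = a}"

definition rational_points ::
  "('i::finite, 'k::{field,finite}) mpoly set \<Rightarrow> nat \<Rightarrow> ('k alg_closure ^ 'i) set set" where
  "rational_points F n = {P \<in> geom_points F. \<exists>x\<in>P. \<forall>i. x $ i \<in> finite_subfield n}"

definition point_count :: "('i::finite, 'k::{field,finite}) mpoly set \<Rightarrow> nat \<Rightarrow> nat" where
  "point_count F n = card (rational_points F n)"

text \<open>The zeta function \<open>exp (\<Sum>n\<ge>1. N\<^sub>n T^n / n)\<close>; the coefficient of index 0 in the exponent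
  is 0, as \<open>x / 0 = 0\<close>.\<close>

definition zeta_fps :: "('i::finite, 'k::{field,finite}) mpoly set \<Rightarrow> complex fps" where
  "zeta_fps F = fps_exp 1 oo Abs_fps (\<lambda>n. of_nat (point_count F n) / of_nat n)"

text \<open>\<open>\<alpha>\<^sub>1, \<dots>, \<alpha>\<^sub>2\<^sub>g\<close> are the reciprocal roots, with multiplicity, of the numerator
  \<open>(1 - T) (1 - q T) Z(T)\<close> of the zeta function.\<close>

definition reciprocal_frobenius_roots ::
  "('i::finite, 'k::{field,finite}) mpoly set \<Rightarrow> nat \<Rightarrow> (nat \<Rightarrow> complex) \<Rightarrow> bool" where
  "reciprocal_frobenius_roots F g \<alpha> \<longleftrightarrow>
     (1 - fps_X) * (1 - fps_const (of_nat CARD('k)) * fps_X) * zeta_fps F =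
     (\<Prod>j\<in>{1..2*g}. 1 - fps_const (\<alpha> j) * fps_X)"

section \<open>The phase group and the extremal quantity\<close>

definition phase_map :: "('r::finite \<Rightarrow> real) \<Rightarrow> int \<Rightarrow> complex ^ 'r" where
  "phase_map \<theta> n = (\<chi> \<nu>. exp (\<i> * of_int n * of_real (\<theta> \<nu>)))"

definition phase_group :: "('r::finite \<Rightarrow> real) \<Rightarrow> (complex ^ 'r) set" where
  "phase_group \<theta> = closure (range (phase_map \<theta>))"

text \<open>Multiplication in \<open>complex ^ 'r\<close> is componentwise. The predicate is meant for compact
  subgroups \<open>G\<close> of the torus, for which exactly one such measure exists.\<close>

definition haar_prob_measure :: "(complex ^ 'r::finite) set \<Rightarrow> (complex ^ 'r) measure \<Rightarrow> bool" where
  "haar_prob_measure G M \<longleftrightarrow>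
     prob_space M \<and> space M = G \<and> sets M = sets (restrict_space borel G) \<and>
     (\<forall>g\<in>G. distr M M (\<lambda>z. g * z) = M)"

definition Linf_norm :: "'a measure \<Rightarrow> ('a \<Rightarrow> complex) \<Rightarrow> ereal" where
  "Linf_norm M f = esssup M (\<lambda>z. ereal (cmod (f z)))"

definition Linf :: "'a measure \<Rightarrow> ('a \<Rightarrow> complex) set" where
  "Linf M = {f \<in> borel_measurable M. Linf_norm M f < \<infinity>}"

text \<open>\<open>q\<^sub>\<Theta>(a)\<close>, with \<open>M\<close> the Haar probability measure of \<open>phase_group \<theta>\<close>; the \<open>\<nu>\<close>-th coordinate
  character is \<open>z \<mapsto> z $ \<nu>\<close>.\<close>

definition q_phase :: "(complex ^ 'r::finite) measure \<Rightarrow> complex ^ 'r \<Rightarrow> ereal" where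
  "q_phase M a =
     Inf {Linf_norm M f | f. f \<in> Linf M \<and> (\<forall>\<nu>. (\<integral>z. f z * cnj (z $ \<nu>) \<partial>M) = a $ \<nu>)}"

end

theory Submission
  imports Defs
begin

text \<open>
  Write \<open>S w = (\<Sum>\<nu>. m\<^sub>\<nu> w\<^sub>\<nu>)\<close>. The logarithmic derivative of the zeta function gives
  \<open>N\<^sub>n = q\<^sup>n + 1 - (\<Sum>j. \<alpha>\<^sub>j\<^sup>n)\<close> (\<open>point_count_eq_power_sums\<close>), and collecting equal normalized roots
  turns the normalized deviation, for \<open>n \<ge> 1\<close>, into \<open>\<bar>S (\<Psi>(n))\<bar>\<close>, where \<open>\<Psi>\<close> is the phase map
  (\<open>power_sum_eq_phase_sum\<close>). What remains concerns the rotation \<open>\<Psi>\<close> alone.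

  The phase group \<open>G\<close> is the closure of the two-sided orbit \<open>\<Psi>(\<int>)\<close>, while the upper limit sees
  only late positive times. Compactness makes up for this: the orbit returns near the identity at
  arbitrarily large positive times, and shifting by such a return time moves any orbit point to a
  late positive time without moving it far. So every nonempty relatively open subset of \<open>G\<close> is
  visited at arbitrarily late times (\<open>frequently_phase_map_in_open\<close>), and the upper limit of any
  continuous real function along the orbit is its maximum on \<open>G\<close>
  (\<open>limsup_phase_map_eq_max\<close>).

  For the comparison with the extremal quantity, the trigonometric polynomial \<open>- S\<close> is itself a
  competitor: the phases being distinct, the coordinate characters differ at \<open>\<Psi>(1)\<close>, hence are
  orthonormal for Haar measure, and \<open>- S\<close> has the Fourier coefficients \<open>- m\<^sub>\<nu>\<close>. Its supremum norm is at
  most the maximum just found (\<open>q_phase_le_trigonometric\<close>).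
\<close>

section \<open>Point counts as power sums of the Frobenius roots\<close>

lemma fps_deriv_linear_factor:
  fixes a :: complex
  shows "fps_deriv (1 - fps_const a * fps_X) =
           - ((1 - fps_const a * fps_X) * Abs_fps (\<lambda>n. a ^ Suc n))"
proof -
  define G where "G = Abs_fps (\<lambda>n. a ^ Suc n)"
  have "(1 - fps_const a * fps_X) * G = fps_const a"
  proof (rule fps_ext)
    fix n
    show "fps_nth ((1 - fps_const a * fps_X) * G) n = fps_nth (fps_const a) n"
      by (cases n) (simp_all add: left_diff_distrib mult.assoc G_def)
  qed
  thus ?thesis
    by (simp add: G_def)
qed

text \<open>This is a logarithmic derivative, in a form free of division.\<close>

lemma fps_deriv_prod_linear_factors:
  fixes a :: "'j \<Rightarrow> complex"
  assumes "finite A"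
  shows "fps_deriv (\<Prod>j\<in>A. 1 - fps_const (a j) * fps_X) =
           - ((\<Prod>j\<in>A. 1 - fps_const (a j) * fps_X) * (\<Sum>j\<in>A. Abs_fps (\<lambda>n. a j ^ Suc n)))"
  using assms
proof (induction A rule: finite_induct)
  case (insert x A)
  define E where "E = (\<lambda>j. 1 - fps_const (a j) * fps_X)"
  define G where "G = (\<lambda>j. Abs_fps (\<lambda>n. a j ^ Suc n))"
  have "fps_deriv (E x) = - (E x * G x)"
    unfolding E_def G_def by (rule fps_deriv_linear_factor)
  moreover have "fps_deriv (\<Prod>j\<in>A. E j) = - ((\<Prod>j\<in>A. E j) * (\<Sum>j\<in>A. G j))"
    unfolding E_def G_def by (rule insert.IH)
  moreover have "e * (- (p * g)) + - (e * h) * p = - (e * p * (h + g))" for e p g h :: "complex fps"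
    by (simp only: distrib_left minus_add_distrib mult_minus_left mult_minus_right mult_ac add_ac)
  ultimately have "fps_deriv (\<Prod>j\<in>insert x A. E j) =
      - ((\<Prod>j\<in>insert x A. E j) * (\<Sum>j\<in>insert x A. G j))"
    by (simp only: prod.insert[OF insert.hyps] sum.insert[OF insert.hyps] fps_deriv_mult)
  thus ?case
    unfolding E_def G_def .
qed simp

text \<open>The derivative of \<open>log Z\<close> has the coefficient \<open>N\<^sub>n\<close> at index \<open>n - 1\<close>. Comparing the logarithmic
  derivatives of \<open>(1 - T) (1 - q T) Z\<close> and of \<open>\<Prod>j. 1 - \<alpha>\<^sub>j T\<close>, each linear factor contributing a
  geometric series, gives the formula.\<close>

lemma point_count_eq_power_sums:
  fixes F :: "('i::finite, 'k::{field,finite}) mpoly set"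
  assumes roots: "reciprocal_frobenius_roots F g \<alpha>" and n: "n \<ge> 1"
  shows "of_nat (point_count F n) = of_nat CARD('k) ^ n + 1 - (\<Sum>j\<in>{1..2*g}. \<alpha> j ^ n)"
proof -
  define Q :: complex where "Q = of_nat CARD('k)"
  define L :: "complex fps" where "L = Abs_fps (\<lambda>n. of_nat (point_count F n) / of_nat n)"
  define G where "G = (\<lambda>a::complex. Abs_fps (\<lambda>n. a ^ Suc n))"
  define E where "E = (\<lambda>a::complex. 1 - fps_const a * fps_X)"
  define P where "P = (\<Prod>j\<in>{1..2*g}. E (\<alpha> j))"
  have Z: "zeta_fps F = fps_exp 1 oo L"
    by (simp add: zeta_fps_def L_def)
  have dZ: "fps_deriv (zeta_fps F) = zeta_fps F * fps_deriv L"
    unfolding Z by (subst fps_compose_deriv) (simp_all add: L_def)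
  have P_eq: "P = E 1 * E Q * zeta_fps F"
    using roots by (simp add: reciprocal_frobenius_roots_def P_def E_def Q_def)
  have dE: "fps_deriv (E a) = - (E a * G a)" for a
    unfolding E_def G_def by (rule fps_deriv_linear_factor)
  \<comment> \<open>both expressions for \<open>P\<close> give \<open>P\<close> times a logarithmic derivative, and \<open>P\<close> cancels\<close>
  have "fps_deriv P = P * (fps_deriv L - G 1 - G Q)"
    unfolding P_eq by (simp add: dE dZ algebra_simps)
  moreover have "fps_deriv P = - (P * (\<Sum>j\<in>{1..2*g}. G (\<alpha> j)))"
    unfolding P_def E_def G_def by (rule fps_deriv_prod_linear_factors) simp
  ultimately have "P * (fps_deriv L - G 1 - G Q) = P * (- (\<Sum>j\<in>{1..2*g}. G (\<alpha> j)))"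
    by simp
  moreover have "P \<noteq> 0"
  proof -
    have "fps_nth (E a) 0 \<noteq> fps_nth 0 0" for a
      by (simp add: E_def)
    hence "E a \<noteq> 0" for a
      by (rule contrapos_nn) (rule arg_cong)
    thus ?thesis
      by (simp add: P_def)
  qed
  ultimately have eq: "fps_deriv L - G 1 - G Q = - (\<Sum>j\<in>{1..2*g}. G (\<alpha> j))"
    using mult_cancel_left by blast
  obtain k where k: "n = Suc k"
    using n by (cases n) auto
  have "fps_nth (fps_deriv L) k = of_nat (point_count F n)"
    by (simp add: L_def k del: of_nat_Suc)
  moreover have "fps_nth (G a) k = a ^ n" for a
    by (simp add: G_def k)
  ultimately show ?thesis
    using arg_cong[OF eq, of "\<lambda>f. fps_nth f k"] by (simp add: fps_sum_nth Q_def algebra_simps)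
qed

section \<open>The phase group\<close>

lemma phase_map_nth: "phase_map \<theta> n $ \<nu> = exp (\<i> * of_int n * of_real (\<theta> \<nu>))"
  by (simp add: phase_map_def)

lemma phase_map_add: "phase_map \<theta> (m + n) = phase_map \<theta> m * phase_map \<theta> n"
  by (simp add: vec_eq_iff phase_map_nth exp_add [symmetric] algebra_simps)

lemma norm_phase_map_nth: "norm (phase_map \<theta> n $ \<nu>) = 1"
  by (simp add: phase_map_nth)

lemma norm_phase_map_mult: "norm (phase_map \<theta> n * x) = norm x"
  by (simp add: norm_vec_def norm_mult norm_phase_map_nth)

lemma norm_phase_group_nth:
  fixes z :: "complex ^ 'r::finite"
  assumes "z \<in> phase_group \<theta>"
  shows "norm (z $ \<nu>) = 1"
proof -
  have "closed {z :: complex ^ 'r. norm (z $ \<nu>) = 1}"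
    by (intro closed_Collect_eq continuous_intros)
  hence "phase_group \<theta> \<subseteq> {z. norm (z $ \<nu>) = 1}"
    unfolding phase_group_def by (intro closure_minimal) (auto simp: norm_phase_map_nth)
  with assms show ?thesis by auto
qed

lemma phase_map_in_phase_group: "phase_map \<theta> n \<in> phase_group \<theta>"
  unfolding phase_group_def by (rule subsetD[OF closure_subset]) simp

lemma compact_phase_group: "compact (phase_group (\<theta> :: 'r::finite \<Rightarrow> real))"
proof -
  have "norm z \<le> real CARD('r)" if "z \<in> phase_group \<theta>" for z :: "complex ^ 'r"
  proof -
    have "norm z \<le> (\<Sum>\<nu>\<in>UNIV. norm (z $ \<nu>))"
      unfolding norm_vec_def by (rule L2_set_le_sum) simp
    also have "\<dots> = real CARD('r)"
      using that by (simp add: norm_phase_group_nth)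
    finally show ?thesis .
  qed
  hence "bounded (phase_group \<theta>)"
    by (auto simp: bounded_iff)
  thus ?thesis
    by (simp add: compact_eq_bounded_closed phase_group_def)
qed

lemma phase_map_mult_in_phase_group:
  fixes \<theta> :: "'r::finite \<Rightarrow> real"
  assumes "z \<in> phase_group \<theta>"
  shows "phase_map \<theta> n * z \<in> phase_group \<theta>"
proof -
  have "(\<lambda>z. phase_map \<theta> n * z) ` closure (range (phase_map \<theta>)) \<subseteq> closure (range (phase_map \<theta>))"
  proof (rule image_closure_subset)
    show "continuous_on (closure (range (phase_map \<theta>))) (\<lambda>z. phase_map \<theta> n * z)"
      by (simp add: times_vec_def continuous_intros)
    show "(\<lambda>z. phase_map \<theta> n * z) ` range (phase_map \<theta>) \<subseteq> closure (range (phase_map \<theta>))"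
      using phase_map_in_phase_group[of \<theta>]
      by (auto simp: phase_group_def phase_map_add [symmetric])
  qed simp
  thus ?thesis
    using assms by (auto simp: phase_group_def)
qed

section \<open>Recurrence at positive times\<close>

text \<open>By compactness two late points \<open>\<Psi>(n)\<close>, \<open>\<Psi>(n')\<close> with \<open>n' - n\<close> large are close together. Translation by
  \<open>\<Psi>(k - n)\<close> is an isometry and carries them to \<open>\<Psi>(k)\<close> and \<open>\<Psi>(k + n' - n)\<close>, so the point \<open>\<Psi>(k)\<close> of
  an open set, at a possibly negative time, is replaced by one at a late positive time.\<close>

lemma frequently_phase_map_in_open:
  assumes "open U" and "U \<inter> phase_group \<theta> \<noteq> {}"
  shows "\<exists>\<^sub>F n in sequentially. phase_map \<theta> (int n) \<in> U"
  unfolding frequently_sequentially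
proof
  fix N :: nat
  have "U \<inter> range (phase_map \<theta>) \<noteq> {}"
    using assms unfolding phase_group_def by (simp add: open_Int_closure_eq_empty)
  then obtain k where "phase_map \<theta> k \<in> U" by blast
  then obtain e where e: "e > 0" "ball (phase_map \<theta> k) e \<subseteq> U"
    using assms(1) openE by blast
  have "seq_compact (phase_group \<theta>)"
    using compact_phase_group compact_eq_seq_compact_metric by blast
  then obtain l r where r: "strict_mono (r :: nat \<Rightarrow> nat)"
    and lim: "((\<lambda>n. phase_map \<theta> (int n)) \<circ> r) \<longlonglongrightarrow> l"
    by (rule seq_compactE[where f = "\<lambda>n. phase_map \<theta> (int n)"])
       (auto simp: phase_map_in_phase_group)
  have "Cauchy (\<lambda>i. phase_map \<theta> (int (r i)))"
    using LIMSEQ_imp_Cauchy[OF lim] by (simp add: o_def)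
  then obtain M where M: "\<And>i j. i \<ge> M \<Longrightarrow> j \<ge> M \<Longrightarrow>
      dist (phase_map \<theta> (int (r i))) (phase_map \<theta> (int (r j))) < e"
    using e(1) unfolding Cauchy_def by meson
  \<comment> \<open>the return time is the difference of two late members of the subsequence, chosen so far
    apart that adding the possibly negative \<open>k\<close> still leaves at least \<open>N\<close>\<close>
  define j where "j = M + (N + nat \<bar>k\<bar>)"
  have gap: "r (M + d) \<ge> r M + d" for d
    using strict_mono_Suc_iff[of r] r by (induction d) (auto simp: Suc_le_eq order.strict_trans1)
  define t where "t = int (r j) - int (r M)"
  have t: "t \<ge> int N + \<bar>k\<bar>"
    using gap[of "N + nat \<bar>k\<bar>"] by (simp add: t_def j_def)
  have "phase_map \<theta> (k + t) - phase_map \<theta> k =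
          phase_map \<theta> (k - int (r M)) * (phase_map \<theta> (int (r j)) - phase_map \<theta> (int (r M)))"
    by (simp add: right_diff_distrib phase_map_add [symmetric] t_def algebra_simps)
  hence "dist (phase_map \<theta> k) (phase_map \<theta> (k + t)) =
           dist (phase_map \<theta> (int (r j))) (phase_map \<theta> (int (r M)))"
    by (subst dist_commute) (simp add: dist_norm norm_phase_map_mult)
  also have "\<dots> < e"
    by (rule M) (simp_all add: j_def)
  finally have "phase_map \<theta> (int (nat (k + t))) \<in> U"
    using e(2) t by auto
  moreover have "nat (k + t) \<ge> N"
    using t by linarith
  ultimately show "\<exists>n\<ge>N. phase_map \<theta> (int n) \<in> U"
    by blast
qed

lemma limsup_phase_map_eq_max:
  fixes \<phi> :: "complex ^ 'r::finite \<Rightarrow> real"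
  assumes cont: "continuous_on UNIV \<phi>"
    and z: "z \<in> phase_group \<theta>" and max: "\<And>w. w \<in> phase_group \<theta> \<Longrightarrow> \<phi> w \<le> \<phi> z"
  shows "limsup (\<lambda>n. ereal (\<phi> (phase_map \<theta> (int n)))) = ereal (\<phi> z)"
proof (rule antisym)
  show "limsup (\<lambda>n. ereal (\<phi> (phase_map \<theta> (int n)))) \<le> ereal (\<phi> z)"
    by (rule Limsup_bounded) (auto intro!: always_eventually max phase_map_in_phase_group)
  show "ereal (\<phi> z) \<le> limsup (\<lambda>n. ereal (\<phi> (phase_map \<theta> (int n))))"
  proof (rule ccontr)
    assume "\<not> ?thesis"
    hence "limsup (\<lambda>n. ereal (\<phi> (phase_map \<theta> (int n)))) < ereal (\<phi> z)"
      by (simp only: not_le)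
    from ereal_dense2[OF this]
    obtain c where c: "limsup (\<lambda>n. ereal (\<phi> (phase_map \<theta> (int n)))) < ereal c" "c < \<phi> z"
      by auto
    have "\<exists>\<^sub>F n in sequentially. phase_map \<theta> (int n) \<in> {w. c < \<phi> w}"
      using c z cont
      by (intro frequently_phase_map_in_open open_Collect_less continuous_intros) auto
    moreover have "\<forall>\<^sub>F n in sequentially. ereal (\<phi> (phase_map \<theta> (int n))) < ereal c"
      using c(1) by (rule Limsup_lessD)
    hence "\<forall>\<^sub>F n in sequentially. phase_map \<theta> (int n) \<in> {w. c < \<phi> w} \<longrightarrow> False"
      by eventually_elim auto
    ultimately have "\<exists>\<^sub>F n in sequentially. False"
      by (rule frequently_rev_mp)
    thus False by simp
  qed
qed

section \<open>Characters and the extremal quantity\<close>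

context
  fixes \<theta> :: "'r::finite \<Rightarrow> real" and M :: "(complex ^ 'r) measure"
  assumes haar: "haar_prob_measure (phase_group \<theta>) M"
begin

lemma haar_prob_space: "prob_space M"
  and space_haar: "space M = phase_group \<theta>"
  and sets_haar: "sets M = sets (restrict_space borel (phase_group \<theta>))"
  using haar by (auto simp: haar_prob_measure_def)

lemma continuous_imp_measurable_haar:
  fixes f :: "complex ^ 'r \<Rightarrow> 'b::topological_space"
  assumes "continuous_on UNIV f"
  shows "f \<in> borel_measurable M"
proof -
  have "f \<in> borel_measurable (restrict_space borel (phase_group \<theta>))"
    using assms by (intro measurable_restrict_space1 borel_measurable_continuous_onI)
  thus ?thesis
    using measurable_cong_sets[OF sets_haar refl] by blast
qed

lemma integral_haar_translate:
  fixes f :: "complex ^ 'r \<Rightarrow> complex"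
  assumes "f \<in> borel_measurable M"
  shows "(\<integral>z. f (phase_map \<theta> n * z) \<partial>M) = (\<integral>z. f z \<partial>M)"
proof -
  have cont: "continuous_on UNIV (\<lambda>z. phase_map \<theta> n * z)"
    by (simp add: times_vec_def continuous_intros)
  have "(\<lambda>z. phase_map \<theta> n * z) \<in> M \<rightarrow>\<^sub>M restrict_space borel (phase_group \<theta>)"
    using continuous_imp_measurable_haar[OF cont]
    by (intro measurable_restrict_space2) (auto simp: space_haar phase_map_mult_in_phase_group)
  hence "(\<lambda>z. phase_map \<theta> n * z) \<in> M \<rightarrow>\<^sub>M M"
    using measurable_cong_sets[OF refl sets_haar] by blast
  hence "(\<integral>z. f z \<partial>distr M M (\<lambda>z. phase_map \<theta> n * z)) = (\<integral>z. f (phase_map \<theta> n * z) \<partial>M)"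
    using assms by (rule integral_distr)
  moreover have "distr M M (\<lambda>z. phase_map \<theta> n * z) = M"
    using haar phase_map_in_phase_group unfolding haar_prob_measure_def by blast
  ultimately show ?thesis by simp
qed

lemma integrable_haar_mult_cnj: "integrable M (\<lambda>z. z $ \<mu> * cnj (z $ \<nu>))"
proof -
  interpret prob_space M by (rule haar_prob_space)
  show ?thesis
    by (rule integrable_const_bound[where B = 1])
       (auto simp: space_haar norm_mult norm_phase_group_nth
             intro!: continuous_imp_measurable_haar continuous_intros AE_I2)
qed

text \<open>Translation by \<open>\<Psi>(1)\<close> preserves the integral of \<open>z\<^sub>\<mu> cnj z\<^sub>\<nu>\<close> and multiplies the integrand by the
  constant \<open>exp (\<i> (\<theta>\<^sub>\<mu> - \<theta>\<^sub>\<nu>))\<close>, which differs from 1 for distinct phases; so the integral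
  vanishes.\<close>

lemma haar_characters_orthonormal:
  assumes distinct: "inj (\<lambda>\<nu>. exp (\<i> * of_real (\<theta> \<nu>)))"
  shows "(\<integral>z. z $ \<mu> * cnj (z $ \<nu>) \<partial>M) = (if \<mu> = \<nu> then 1 else 0)"
proof (cases "\<mu> = \<nu>")
  case True
  interpret prob_space M by (rule haar_prob_space)
  have "(\<integral>z. z $ \<mu> * cnj (z $ \<nu>) \<partial>M) = (\<integral>z. 1 \<partial>M)"
    by (rule Bochner_Integration.integral_cong)
       (auto simp: True space_haar norm_phase_group_nth complex_norm_square [symmetric])
  thus ?thesis
    using True by (simp add: prob_space)
next
  case False
  let ?I = "\<integral>z. z $ \<mu> * cnj (z $ \<nu>) \<partial>M"
  let ?u = "\<lambda>\<nu>. phase_map \<theta> 1 $ \<nu>"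
  have "?I = (\<integral>z. (?u \<mu> * cnj (?u \<nu>)) * (z $ \<mu> * cnj (z $ \<nu>)) \<partial>M)"
    by (subst integral_haar_translate[of _ 1, symmetric])
       (auto simp: mult_ac intro!: continuous_imp_measurable_haar continuous_intros)
  also have "\<dots> = ?u \<mu> * cnj (?u \<nu>) * ?I"
    by simp
  finally have "?I = ?u \<mu> * cnj (?u \<nu>) * ?I" .
  moreover have "?u \<mu> * cnj (?u \<nu>) \<noteq> 1"
  proof
    assume 1: "?u \<mu> * cnj (?u \<nu>) = 1"
    have "cnj (?u \<nu>) * ?u \<nu> = 1"
      by (simp add: mult.commute complex_norm_square [symmetric] norm_phase_map_nth)
    hence "?u \<mu> = ?u \<nu>"
      using 1 by (metis mult.assoc mult.left_neutral mult.right_neutral)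
    thus False
      using injD[OF distinct, of \<mu> \<nu>] False by (simp add: phase_map_nth)
  qed
  ultimately show ?thesis
    using False by simp
qed

text \<open>The trigonometric polynomial with coefficient vector \<open>a\<close> is admissible in the infimum that
  defines \<open>q_phase M a\<close>, by orthonormality of the characters.\<close>

lemma q_phase_le_trigonometric:
  assumes distinct: "inj (\<lambda>\<nu>. exp (\<i> * of_real (\<theta> \<nu>)))"
    and bound: "\<And>w. w \<in> phase_group \<theta> \<Longrightarrow> cmod (\<Sum>\<nu>\<in>UNIV. a $ \<nu> * w $ \<nu>) \<le> B"
  shows "q_phase M a \<le> ereal B"
proof -
  define f where "f = (\<lambda>w :: complex ^ 'r. \<Sum>\<nu>\<in>UNIV. a $ \<nu> * w $ \<nu>)"
  have meas: "f \<in> borel_measurable M"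
    unfolding f_def by (intro continuous_imp_measurable_haar continuous_intros)
  have norm_le: "Linf_norm M f \<le> ereal B"
    unfolding Linf_norm_def using meas bound
    by (intro esssup_I) (auto simp: f_def space_haar intro!: AE_I2)
  hence "f \<in> Linf M"
    using meas by (auto simp: Linf_def intro: le_less_trans)
  moreover have "(\<integral>z. f z * cnj (z $ \<nu>) \<partial>M) = a $ \<nu>" for \<nu>
  proof -
    have "(\<integral>z. f z * cnj (z $ \<nu>) \<partial>M) = (\<integral>z. (\<Sum>\<mu>\<in>UNIV. a $ \<mu> * (z $ \<mu> * cnj (z $ \<nu>))) \<partial>M)"
      by (simp add: f_def sum_distrib_right mult.assoc)
    also have "\<dots> = (\<Sum>\<mu>\<in>UNIV. a $ \<mu> * (\<integral>z. z $ \<mu> * cnj (z $ \<nu>) \<partial>M))"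
      by (subst Bochner_Integration.integral_sum) (auto simp: integrable_haar_mult_cnj)
    also have "\<dots> = a $ \<nu>"
      by (simp add: haar_characters_orthonormal[OF distinct] if_distrib cong: if_cong)
    finally show ?thesis .
  qed
  ultimately have "q_phase M a \<le> Linf_norm M f"
    unfolding q_phase_def by (intro Inf_lower) blast
  with norm_le show ?thesis by (rule order_trans[rotated])
qed

end

section \<open>The deviation of the point counts\<close>

lemma power_sum_eq_phase_sum:
  fixes \<alpha> :: "'j \<Rightarrow> complex" and s :: real and \<theta> :: "'r::finite \<Rightarrow> real"
  assumes "finite J" and s: "s > 0"
    and distinct: "inj (\<lambda>\<nu>. exp (\<i> * of_real (\<theta> \<nu>)))"
    and phases: "range (\<lambda>\<nu>. exp (\<i> * of_real (\<theta> \<nu>))) = (\<lambda>j. \<alpha> j / of_real s) ` J"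
    and mult: "\<And>\<nu>. m \<nu> = card {j \<in> J. \<alpha> j / of_real s = exp (\<i> * of_real (\<theta> \<nu>))}"
  shows "(\<Sum>j\<in>J. \<alpha> j ^ n) =
           of_real (s ^ n) * (\<Sum>\<nu>\<in>UNIV. of_nat (m \<nu>) * phase_map \<theta> (int n) $ \<nu>)"
proof -
  let ?e = "\<lambda>\<nu>. exp (\<i> * of_real (\<theta> \<nu>)) :: complex"
  let ?\<beta> = "\<lambda>j. \<alpha> j / of_real s"
  have "(\<Sum>j\<in>J. ?\<beta> j ^ n) = (\<Sum>u\<in>range ?e. \<Sum>j\<in>{j \<in> J. ?\<beta> j = u}. ?\<beta> j ^ n)"
    using assms(1) phases by (intro sum.group[symmetric]) auto
  also have "\<dots> = (\<Sum>\<nu>\<in>UNIV. \<Sum>j\<in>{j \<in> J. ?\<beta> j = ?e \<nu>}. ?\<beta> j ^ n)"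
    by (simp add: sum.reindex[OF distinct])
  also have "\<dots> = (\<Sum>\<nu>\<in>UNIV. of_nat (m \<nu>) * phase_map \<theta> (int n) $ \<nu>)"
  proof (rule sum.cong[OF refl])
    fix \<nu>
    have "?e \<nu> ^ n = phase_map \<theta> (int n) $ \<nu>"
      by (simp add: phase_map_nth exp_of_nat_mult [symmetric] mult_ac)
    thus "(\<Sum>j\<in>{j \<in> J. ?\<beta> j = ?e \<nu>}. ?\<beta> j ^ n) = of_nat (m \<nu>) * phase_map \<theta> (int n) $ \<nu>"
      by (simp add: mult)
  qed
  finally have "(\<Sum>j\<in>J. ?\<beta> j ^ n) = (\<Sum>\<nu>\<in>UNIV. of_nat (m \<nu>) * phase_map \<theta> (int n) $ \<nu>)" .
  moreover have "(\<Sum>j\<in>J. \<alpha> j ^ n) = of_real (s ^ n) * (\<Sum>j\<in>J. ?\<beta> j ^ n)"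
    using s by (simp add: sum_distrib_left power_divide)
  ultimately show ?thesis by simp
qed

theorem theorem36p1:
  fixes F :: "('i::finite, 'k::{field,finite}) mpoly set"
    and g :: nat
    and \<alpha> :: "nat \<Rightarrow> complex"
    and \<theta> :: "'r::finite \<Rightarrow> real"
    and m :: "'r \<Rightarrow> nat"
  defines "q \<equiv> real CARD('k)"
  defines "N \<equiv> point_count F"
  assumes curve: "smooth_proj_geom_conn_curve F"
    and genus_eq: "genus F = of_nat g" "g \<ge> 1"
    and roots: "reciprocal_frobenius_roots F g \<alpha>"
    and phases_distinct: "inj (\<lambda>\<nu>. exp (\<i> * of_real (\<theta> \<nu>)))"
    and phases: "range (\<lambda>\<nu>. exp (\<i> * of_real (\<theta> \<nu>))) = (\<lambda>j. \<alpha> j / of_real (sqrt q)) ` {1..2*g}"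
    and multiplicities:
      "\<And>\<nu>. m \<nu> = card {j \<in> {1..2*g}. \<alpha> j / of_real (sqrt q) = exp (\<i> * of_real (\<theta> \<nu>))}"
  shows "(\<forall>M. haar_prob_measure (phase_group \<theta>) M \<longrightarrow>
            limsup (\<lambda>n. ereal (\<bar>real (N n) - q ^ n - 1\<bar> / q powr (real n / 2)))
              \<ge> q_phase M (\<chi> \<nu>. - of_nat (m \<nu>))) \<and>
         (\<exists>z\<in>phase_group \<theta>.
            (\<forall>w\<in>phase_group \<theta>.
               cmod (\<Sum>\<nu>\<in>UNIV. of_nat (m \<nu>) * w $ \<nu>) \<le> cmod (\<Sum>\<nu>\<in>UNIV. of_nat (m \<nu>) * z $ \<nu>)) \<and>
            limsup (\<lambda>n. ereal (\<bar>real (N n) - q ^ n - 1\<bar> / q powr (real n / 2)))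
              = ereal (cmod (\<Sum>\<nu>\<in>UNIV. of_nat (m \<nu>) * z $ \<nu>)))"
proof -
  define S where "S = (\<lambda>w :: complex ^ 'r. \<Sum>\<nu>\<in>UNIV. of_nat (m \<nu>) * w $ \<nu>)"
  have q: "q > 0"
    by (simp add: q_def)
  have S_cont: "continuous_on A (\<lambda>w. cmod (S w))" for A
    unfolding S_def by (intro continuous_intros)
  have "phase_group \<theta> \<noteq> {}"
    using phase_map_in_phase_group by blast
  then obtain z where z: "z \<in> phase_group \<theta>"
    and max: "\<And>w. w \<in> phase_group \<theta> \<Longrightarrow> cmod (S w) \<le> cmod (S z)"
    using continuous_attains_sup[OF compact_phase_group _ S_cont] by blast
  have deviation: "\<bar>real (N n) - q ^ n - 1\<bar> / q powr (real n / 2) = cmod (S (phase_map \<theta> (int n)))"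
    if n: "n \<ge> 1" for n
  proof -
    have pow: "q powr (real n / 2) = sqrt q ^ n"
      using q by (simp add: powr_half_sqrt [symmetric] powr_powr powr_realpow [symmetric])
    have "complex_of_real (real (N n) - q ^ n - 1) = - (\<Sum>j\<in>{1..2*g}. \<alpha> j ^ n)"
      using point_count_eq_power_sums[OF roots n] by (simp add: N_def q_def)
    also have "\<dots> = - (of_real (sqrt q ^ n) * S (phase_map \<theta> (int n)))"
      unfolding S_def
      by (subst power_sum_eq_phase_sum[OF _ _ phases_distinct phases multiplicities])
         (use q in simp_all)
    finally have "cmod (of_real (real (N n) - q ^ n - 1)) =
        cmod (- (of_real (sqrt q ^ n) * S (phase_map \<theta> (int n))))"
      by (rule arg_cong)
    hence "\<bar>real (N n) - q ^ n - 1\<bar> = sqrt q ^ n * cmod (S (phase_map \<theta> (int n)))"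
      using q unfolding norm_of_real by (simp add: norm_mult norm_power)
    thus ?thesis
      using q by (simp add: pow)
  qed
  have "limsup (\<lambda>n. ereal (\<bar>real (N n) - q ^ n - 1\<bar> / q powr (real n / 2))) =
          limsup (\<lambda>n. ereal (cmod (S (phase_map \<theta> (int n)))))"
    by (rule Limsup_eq) (auto simp: deviation intro!: eventually_sequentiallyI[of 1])
  also have "\<dots> = ereal (cmod (S z))"
    using S_cont z max by (rule limsup_phase_map_eq_max)
  finally have limsup_eq: "limsup (\<lambda>n. ereal (\<bar>real (N n) - q ^ n - 1\<bar> / q powr (real n / 2))) =
      ereal (cmod (S z))" .
  have "q_phase M (\<chi> \<nu>. - of_nat (m \<nu>)) \<le> ereal (cmod (S z))"
    if "haar_prob_measure (phase_group \<theta>) M" for M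
    using max by (intro q_phase_le_trigonometric[OF that phases_distinct])
                 (auto simp: S_def sum_negf)
  thus ?thesis
    using limsup_eq z max unfolding S_def by auto
qed

end
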